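(* Let $r \geq 2$ and $e > 0$ be integers and let $\mathsf{s} = (s_1,\dots,s_r) \in \mathbb{Z}^r$. Then $$Q^{\mathsf{s}} \supseteq \bigl\{\alpha \in Q : \mathsf{w}^{\mathsf{s}}(\alpha) > N'_{r,e} - r\bigr\}, \qquad\text{where } N'_{r,e} := \left\lfloor \frac{r^2}{2e}\left\lfloor\frac{e^2}{4}\right\rfloor\right\rfloor .$$
   Context: A partition is a finite non-increasing sequence $\lambda = (\lambda_1\geq\dots\geq\lambda_h>0)$ of positive integers (possibly empty), with Young diagram $\{(a,b): 1\le a\le h,\ 1\le b\le \lambda_a\}$. An $r$-partition is an $r$-tuple $\boldsymbol\lambda=(\lambda^{(1)},\dots,\lambda^{(r)})$ of partitions; its nodes are the triples $(a,b,j)$ with $j\in\{1,\dots,r\}$ and $(a,b)$ in the Young diagram of $\lambda^{(j)}$. For a multicharge $\mathsf{s}=(s_1,\dots,s_r)\in\mathbb{Z}^r$, the $\mathsf{s}$-residue of $(a,b,j)$ is $b-a+s_j \bmod e \in\mathbb{Z}/e\mathbb{Z}$, and $c_i^{\mathsf{s}}(\boldsymbol\lambda)$ is the number of nodes of $\boldsymbol\lambda$ of $\mathsf{s}$-residue $i$. $Q=\bigoplus_{i\in\mathbb{Z}/e\mathbb{Z}}\mathbb{Z}\alpha_i$ is the free abelian group with basis $(\alpha_i)_{i\in\mathbb{Z}/e\mathbb{Z}}$. Set $\alpha^{\mathsf{s}}(\boldsymbol\lambda):=\sum_{i}c_i^{\mathsf{s}}(\boldsymbol\lambda)\alpha_i\in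 Q$ and $Q^{\mathsf{s}}:=\{\alpha^{\mathsf{s}}(\boldsymbol\lambda):\boldsymbol\lambda\text{ an }r\text{-partition}\}$. For $\alpha=\sum_i c_i\alpha_i\in Q$, its $\mathsf{s}$-weight is $\mathsf{w}^{\mathsf{s}}(\alpha):=\sum_{j=1}^r c_{s_j}-\frac12\sum_{i\in\mathbb{Z}/e\mathbb{Z}}(c_i-c_{i+1})^2\in\mathbb{Z}$, where the index $s_j$ is read modulo $e$. *)

theory Defs
  imports Complex_Main "HOL-Algebra.Free_Abelian_Groups"
begin

(* Tuples are lists and are indexed from 0: the component numbered j+1 in the usual
   convention is entry j here.  Rows and columns of Young diagrams are indexed from 1. *)

definition is_partition :: "nat list \<Rightarrow> bool" where
  "is_partition l \<longleftrightarrow> sorted_wrt (\<ge>) l \<and> (\<forall>x \<in> set l. 0 < x)"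

definition young_diagram :: "nat list \<Rightarrow> (nat \<times> nat) set" where
  "young_diagram l = {(a, b). 1 \<le> a \<and> a \<le> length l \<and> 1 \<le> b \<and> b \<le> l ! (a - 1)}"

definition multipartitions :: "nat \<Rightarrow> nat list list set" where
  "multipartitions r = {L. length L = r \<and> (\<forall>l \<in> set L. is_partition l)}"

definition nodes :: "nat list list \<Rightarrow> (nat \<times> nat \<times> nat) set" where
  "nodes L = {(a, b, j). j < length L \<and> (a, b) \<in> young_diagram (L ! j)}"

(* The group Z/eZ (for e > 0) is represented by its standard representatives {0..<e}. *)

definition residue :: "int \<Rightarrow> int list \<Rightarrow> nat \<times> nat \<times> nat \<Rightarrow> int" where
  "residue e s = (\<lambda>(a, b, j). (int b - int a + s ! j) mod e)"

definition residue_count :: "int \<Rightarrow> int list \<Rightarrow> nat list list \<Rightarrow> int \<Rightarrow> nat" where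
  "residue_count e s L i = card {x \<in> nodes L. residue e s x = i}"

(* The basis element alpha_i is frag_of i, the coefficient c_i of an element
   alpha is Poly_Mapping.lookup alpha i. *)

definition root_lattice :: "int \<Rightarrow> (int \<Rightarrow>\<^sub>0 int) set" where
  "root_lattice e = carrier (free_Abelian_group {0..<e})"

definition content :: "int \<Rightarrow> int list \<Rightarrow> nat list list \<Rightarrow> (int \<Rightarrow>\<^sub>0 int)" where
  "content e s L = (\<Sum>i\<in>{0..<e}. frag_cmul (int (residue_count e s L i)) (frag_of i))"

definition contents :: "int \<Rightarrow> int list \<Rightarrow> (int \<Rightarrow>\<^sub>0 int) set" where
  "contents e s = content e s ` multipartitions (length s)"

(* The integer division by 2 is exact, see weight_eq below. *)

definition weight :: "int \<Rightarrow> int list \<Rightarrow> (int \<Rightarrow>\<^sub>0 int) \<Rightarrow> int" where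
  "weight e s \<alpha> =
     (\<Sum>j<length s. Poly_Mapping.lookup \<alpha> ((s ! j) mod e))
     - (\<Sum>i\<in>{0..<e}. (Poly_Mapping.lookup \<alpha> i - Poly_Mapping.lookup \<alpha> ((i + 1) mod e))\<^sup>2) div 2"

lemma sum_cyclic_shift:
  fixes e :: int and f :: "int \<Rightarrow> int"
  assumes "e > 0"
  shows "(\<Sum>i\<in>{0..<e}. f ((i + 1) mod e)) = (\<Sum>i\<in>{0..<e}. f i)"
proof (rule sum.reindex_bij_witness[where i = "\<lambda>i. (i - 1) mod e" and j = "\<lambda>i. (i + 1) mod e"])
qed (use assms in \<open>auto simp: mod_simps\<close>)

lemma weight_eq:
  assumes "e > 0"
  shows "of_int (weight e s \<alpha>) =
     (\<Sum>j<length s. real_of_int (Poly_Mapping.lookup \<alpha> ((s ! j) mod e)))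
     - 1 / 2 * (\<Sum>i\<in>{0..<e}.
         (real_of_int (Poly_Mapping.lookup \<alpha> i) - real_of_int (Poly_Mapping.lookup \<alpha> ((i + 1) mod e)))\<^sup>2)"
proof -
  define c where "c = Poly_Mapping.lookup \<alpha>"
  define S where "S = (\<Sum>i\<in>{0..<e}. (c i - c ((i + 1) mod e))\<^sup>2)"
  have "(\<Sum>i\<in>{0..<e}. c i - c ((i + 1) mod e)) = 0"
    using sum_cyclic_shift[OF assms, of c] by (simp add: sum_subtractf)
  then have "S = (\<Sum>i\<in>{0..<e}. (c i - c ((i + 1) mod e))\<^sup>2 - (c i - c ((i + 1) mod e)))"
    by (simp add: S_def sum_subtractf)
  moreover have "even (\<Sum>i\<in>{0..<e}. (c i - c ((i + 1) mod e))\<^sup>2 - (c i - c ((i + 1) mod e)))"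
    by (rule dvd_sum) simp
  ultimately have "even S" by simp
  then have "real_of_int (S div 2) = real_of_int S / 2"
    by (auto elim!: evenE)
  then show ?thesis
    by (simp add: weight_def S_def c_def)
qed

definition N' :: "nat \<Rightarrow> int \<Rightarrow> int" where
  "N' r e = \<lfloor>(real r)\<^sup>2 / (2 * real_of_int e) * real_of_int \<lfloor>(real_of_int e)\<^sup>2 / 4\<rfloor>\<rfloor>"

end

theory Submission
  imports Defs
begin

text \<open>
  Write \<open>c\<^sub>i\<close> for the coefficients of \<open>\<alpha>\<close> and \<open>\<delta> = \<Sum>\<^sub>i \<alpha>\<^sub>i\<close>. The components of a multipartition are
  independent of each other, so \<open>\<alpha>\<close> is a content as soon as it is a sum of \<open>r\<close> elements of \<open>Q\<close>, the
  \<open>j\<close>-th of which is the content of a single partition of charge \<open>s\<^sub>j\<close>. By a construction on the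
  abacus, every element of nonnegative weight for a single charge is the content of a partition
  of that charge (lemma \<open>partition_with_residue_counts\<close>). Moreover, adding \<open>\<delta>\<close> to an element raises
  its weight for a single charge by one. Hence it suffices to write \<open>\<alpha>\<close> as a sum of \<open>r\<close> elements
  whose weights have a nonnegative total: multiples of \<open>\<delta>\<close> that add up to zero then make all the
  weights nonnegative.

  The sum of the weights over all \<open>r\<^sup>2\<close> pairs of a charge and a summand has linear terms that do
  not depend on the choice of the summands, and quadratic terms that are largest when the vectors
  of cyclic differences of the summands are as equal as possible. The summands are therefore
  taken to be the functions \<open>\<lfloor>(c\<^sub>i + k) / r\<rfloor>\<close> for \<open>0 \<le> k < r\<close>. By Hermite's identity they add up
  to \<open>c\<^sub>i\<close>, and their cyclic differences are roundings of \<open>(c\<^sub>i - c\<^sub>i\<^sub>+\<^sub>1) / r\<close>. It remains to decide which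
  summand goes to which charge. The sum of the weights over all pairs is the weight of \<open>\<alpha>\<close>
  minus half of \<open>\<Sum>\<^sub>i t\<^sub>i (r - t\<^sub>i)\<close>, where \<open>t\<^sub>i\<close> is the remainder of
  \<open>c\<^sub>i - c\<^sub>i\<^sub>+\<^sub>1\<close> modulo \<open>r\<close> (lemma \<open>sum_level_one_weights\<close>). As \<open>r\<close> divides the sum of the \<open>t\<^sub>i\<close>, this
  correction is at most \<open>N'\<close> (lemmas \<open>sum_residue_defects_le\<close> and \<open>le_N'I\<close>), so the sum over all
  pairs is greater than \<open>- r\<close>. The pairs are partitioned by the \<open>r\<close> cyclic assignments of
  summands to charges, so one of these has a total weight greater than \<open>- 1\<close>
  (lemma \<open>exists_cyclic_assignment\<close>).
\<close>

section \<open>Young diagrams and beta-sets\<close>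

lemma is_partition_Cons:
  "is_partition (x # l) \<longleftrightarrow> 0 < x \<and> (\<forall>y\<in>set l. y \<le> x) \<and> is_partition l"
  by (auto simp: is_partition_def)

lemma young_diagram_Nil [simp]: "young_diagram [] = {}"
  by (auto simp: young_diagram_def)

lemma finite_young_diagram: "finite (young_diagram l)"
proof (rule finite_subset)
  show "young_diagram l \<subseteq> (\<Union>a\<in>{1..length l}. {a} \<times> {1..l ! (a - 1)})"
    by (auto simp: young_diagram_def)
qed auto

lemma young_diagram_Cons:
  "young_diagram (x # l) = Pair 1 ` {1..x} \<union> map_prod Suc id ` young_diagram l"
proof (intro equalityI subsetI)
  fix y assume "y \<in> young_diagram (x # l)"
  then obtain a b where y: "y = (a, b)" "1 \<le> a" "a \<le> Suc (length l)" "1 \<le> b" "b \<le> (x # l) ! (a - 1)"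
    by (auto simp: young_diagram_def)
  show "y \<in> Pair 1 ` {1..x} \<union> map_prod Suc id ` young_diagram l"
  proof (cases "a = 1")
    case False
    then have "(a - 1, b) \<in> young_diagram l" "y = map_prod Suc id (a - 1, b)"
      using y by (auto simp: young_diagram_def nth_Cons')
    then show ?thesis by blast
  qed (use y in auto)
next
  fix y assume "y \<in> Pair 1 ` {1..x} \<union> map_prod Suc id ` young_diagram l"
  then show "y \<in> young_diagram (x # l)"
    by (auto simp: young_diagram_def nth_Cons')
qed

text \<open>
  Residues depend only on \<open>b - a\<close>. Summing an arbitrary function of it, rather than counting one
  residue, lets an induction on rows absorb the shift by one between consecutive rows.
\<close>

definition diagram_sum :: "(int \<Rightarrow> int) \<Rightarrow> nat list \<Rightarrow> int" where
  "diagram_sum f l = (\<Sum>(a, b)\<in>young_diagram l. f (int b - int a))"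

lemma diagram_sum_Nil [simp]: "diagram_sum f [] = 0"
  by (simp add: diagram_sum_def)

lemma diagram_sum_Cons:
  "diagram_sum f (x # l) = (\<Sum>b\<in>{1..x}. f (int b - 1)) + diagram_sum (\<lambda>z. f (z - 1)) l"
proof -
  have "diagram_sum f (x # l) = (\<Sum>(a, b)\<in>Pair 1 ` {1..x}. f (int b - int a))
     + (\<Sum>(a, b)\<in>map_prod Suc id ` young_diagram l. f (int b - int a))"
    unfolding diagram_sum_def young_diagram_Cons
    by (rule sum.union_disjoint)
      (use finite_young_diagram[of l] in \<open>auto simp: young_diagram_def[of l]\<close>)
  also have "(\<Sum>(a, b)\<in>Pair (1::nat) ` {1..x}. f (int b - int a)) = (\<Sum>b\<in>{1..x}. f (int b - 1))"
    by (subst sum.reindex) (auto simp: inj_on_def)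
  also have "(\<Sum>(a, b)\<in>map_prod Suc id ` young_diagram l. f (int b - int a))
      = diagram_sum (\<lambda>z. f (z - 1)) l"
    unfolding diagram_sum_def
    by (subst sum.reindex) (auto simp: inj_on_def intro!: sum.cong arg_cong[where f = f])
  finally show ?thesis .
qed

text \<open>
  A set \<open>B\<close> of \<open>n\<close> bead positions \<open>\<beta>\<^sub>1 > \<dots> > \<beta>\<^sub>n\<close> encodes the partition with rows
  \<open>\<lambda>\<^sub>a = \<beta>\<^sub>a - (n - a)\<close>. Row \<open>a\<close> has the values \<open>b - a = v - n\<close> for \<open>n - a < v \<le> \<beta>\<^sub>a\<close>, and writing this
  range of \<open>v\<close> as a difference of two initial ranges turns the sum over the diagram into a sum over
  \<open>B\<close> that does not depend on the order of the beads. Adding the largest bead prepends a row;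
  the bound on the parts ensures that this row is the longest one.
\<close>

lemma partition_of_beta_set:
  assumes "finite B"
  shows "\<exists>l. is_partition l \<and> (\<forall>x\<in>set l. \<exists>b\<in>B. x + card B \<le> Suc b) \<and>
    (\<forall>f. diagram_sum f l = (\<Sum>b\<in>B. \<Sum>v\<in>{1..b}. f (int v - int (card B)))
       - (\<Sum>b<card B. \<Sum>v\<in>{1..b}. f (int v - int (card B))))"
  using assms
proof (induction B rule: finite_linorder_max_induct)
  case empty
  show ?case by (intro exI[of _ "[]"]) (simp add: is_partition_def)
next
  case (insert \<beta> B)
  define n where "n = card B"
  have "B \<subseteq> {..<\<beta>}" using insert.hyps by auto
  then have n: "n \<le> \<beta>" unfolding n_def using card_mono[of "{..<\<beta>}" B] by simp
  have card: "card (insert \<beta> B) = Suc n" using insert.hyps by (auto simp: n_def)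
  from insert.IH obtain l where l: "is_partition l" "\<forall>x\<in>set l. \<exists>b\<in>B. x + n \<le> Suc b"
    and sum: "\<And>f. diagram_sum f l = (\<Sum>b\<in>B. \<Sum>v\<in>{1..b}. f (int v - int n))
       - (\<Sum>b<n. \<Sum>v\<in>{1..b}. f (int v - int n))"
    unfolding n_def by blast
  have le: "x + n \<le> \<beta>" if "x \<in> set l" for x
    using l(2) that insert.hyps(2) by fastforce
  define l' where "l' = (if \<beta> = n then [] else (\<beta> - n) # l)"
  \<comment> \<open>In this case \<open>B = {..<n}\<close>, so the new row and all rows of \<open>l\<close> are empty.\<close>
  have nil: "l = []" if "\<beta> = n"
  proof (rule ccontr)
    assume "l \<noteq> []"
    then have "hd l \<in> set l" by simp
    with le[of "hd l"] l(1) that show False by (auto simp: is_partition_def)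
  qed
  have "is_partition l'"
    using l(1) le n by (force simp: l'_def is_partition_Cons is_partition_def[of "[]"])
  moreover have "\<forall>x\<in>set l'. \<exists>b\<in>insert \<beta> B. x + Suc n \<le> Suc b"
    using le n by (auto simp: l'_def)
  moreover have "diagram_sum f l' = (\<Sum>b\<in>insert \<beta> B. \<Sum>v\<in>{1..b}. f (int v - int (Suc n)))
       - (\<Sum>b<Suc n. \<Sum>v\<in>{1..b}. f (int v - int (Suc n)))" for f
  proof -
    have "diagram_sum f l' = (\<Sum>b\<in>{1..\<beta> - n}. f (int b - 1)) + diagram_sum (\<lambda>z. f (z - 1)) l"
      using nil by (auto simp: l'_def diagram_sum_Cons)
    also have "(\<Sum>b\<in>{1..\<beta> - n}. f (int b - 1)) = (\<Sum>v\<in>{Suc n..\<beta>}. f (int v - int (Suc n)))"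
      by (rule sum.reindex_bij_witness[where i = "\<lambda>v. v - n" and j = "\<lambda>b. b + n"]) (use n in auto)
    also have "\<dots> = (\<Sum>v\<in>{1..\<beta>}. f (int v - int (Suc n))) - (\<Sum>v\<in>{1..n}. f (int v - int (Suc n)))"
    proof -
      have "{1..\<beta>} = {1..n} \<union> {Suc n..\<beta>}" using n by auto
      then show ?thesis by (simp add: sum.union_disjoint)
    qed
    also have "diagram_sum (\<lambda>z. f (z - 1)) l = (\<Sum>b\<in>B. \<Sum>v\<in>{1..b}. f (int v - int (Suc n)))
       - (\<Sum>b<n. \<Sum>v\<in>{1..b}. f (int v - int (Suc n)))"
      unfolding sum by (simp add: algebra_simps)
    finally show ?thesis
      using insert.hyps by (subst sum.insert) auto
  qed
  ultimately show ?case unfolding card by blast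
qed


section \<open>Functions on residues and their weight\<close>

lemma sum_residues:
  fixes e :: int and f :: "int \<Rightarrow> int"
  assumes "e > 0"
  shows "(\<Sum>p<nat e. f ((int p + t) mod e)) = (\<Sum>i\<in>{0..<e}. f i)"
  by (rule sum.reindex_bij_witness[where i = "\<lambda>i. nat ((i - t) mod e)" and j = "\<lambda>p. (int p + t) mod e"])
    (use assms in \<open>auto simp: mod_simps nat_less_iff\<close>)

lemma cyclically_constant:
  fixes e :: int
  assumes "\<And>i. i \<in> {0..<e} \<Longrightarrow> h i = h ((i + 1) mod e)" and "i \<in> {0..<e}" "j \<in> {0..<e}"
  shows "h i = h j"
proof -
  have "h (int k) = h 0" if "int k < e" for k
    using that
  proof (induction k)
    case (Suc k)
    then have "h (int k) = h (int (Suc k))" using assms(1)[of "int k"] by (simp add: add.commute)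
    then show ?case using Suc by simp
  qed simp
  from this[of "nat i"] this[of "nat j"] show ?thesis using assms(2,3) by simp
qed

text \<open>
  The quadratic part of the weight. It sees \<open>c\<close> only through its cyclic differences, so it does
  not change when a multiple of \<open>\<delta> = \<Sum>\<^sub>i \<alpha>\<^sub>i\<close> is added to \<open>c\<close>.
\<close>

definition energy :: "int \<Rightarrow> (int \<Rightarrow> int) \<Rightarrow> int" where
  "energy e c = (\<Sum>i\<in>{0..<e}. (c i - c ((i + 1) mod e))\<^sup>2)"

lemma sum_cyclic_differences:
  fixes c :: "int \<Rightarrow> int"
  assumes "e > 0"
  shows "(\<Sum>i\<in>{0..<e}. c i - c ((i + 1) mod e)) = 0"
  using sum_cyclic_shift[OF assms, of c] by (simp add: sum_subtractf)

lemma even_energy: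
  assumes "e > 0"
  shows "even (energy e c)"
proof -
  have "energy e c = (\<Sum>i\<in>{0..<e}. (c i - c ((i + 1) mod e))\<^sup>2 - (c i - c ((i + 1) mod e)))"
    using sum_cyclic_differences[OF assms, of c] by (simp add: energy_def sum_subtractf)
  moreover have "even \<dots>"
    by (rule dvd_sum) simp
  ultimately show ?thesis by simp
qed

text \<open>
  The weight with respect to the one-element multicharge \<open>[t]\<close>.
\<close>

definition level_one_weight :: "int \<Rightarrow> int \<Rightarrow> (int \<Rightarrow> int) \<Rightarrow> int" where
  "level_one_weight e t c = c (t mod e) - energy e c div 2"

lemma twice_level_one_weight:
  "e > 0 \<Longrightarrow> 2 * level_one_weight e t c = 2 * c (t mod e) - energy e c"
  using even_energy[of e c] by (auto simp: level_one_weight_def)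

text \<open>
  Adding \<open>\<delta>\<close> raises the weight by one. This is what makes weight transferable between components
  of a multipartition without changing the total content.
\<close>

lemma level_one_weight_add_const:
  "level_one_weight e t (\<lambda>i. c i + b) = level_one_weight e t c + b"
  by (simp add: level_one_weight_def energy_def)

section \<open>Partitions with prescribed residue counts\<close>

text \<open>
  The number of nodes of residue \<open>i\<close> passed when a bead moves from position \<open>0\<close> to position \<open>b\<close>.
  Residue counts of a partition are differences of sums of this function over bead positions.
\<close>

definition residue_hits :: "int \<Rightarrow> int \<Rightarrow> int \<Rightarrow> nat \<Rightarrow> int" where
  "residue_hits e t i b = (\<Sum>v\<in>{1..b}. of_bool ((int v + t) mod e = i))"

text \<open>
  Stepping from \<open>v\<close> to \<open>v + 1\<close> raises the residue by one, so the hits of \<open>i\<close> and of \<open>i + 1\<close> match up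
  except at the two ends of the range.
\<close>

lemma residue_hits_diff:
  assumes "i \<in> {0..<e}"
  shows "residue_hits e t i b - residue_hits e t ((i + 1) mod e) b
    = of_bool ((int b + t) mod e = i) - of_bool (t mod e = i)"
proof (induction b)
  case (Suc b)
  have "(int (Suc b) + t) mod e = (i + 1) mod e \<longleftrightarrow> (int b + t) mod e = i mod e"
    by (simp add: mod_eq_dvd_iff algebra_simps)
  also have "i mod e = i" using assms by simp
  finally show ?case using Suc by (simp add: residue_hits_def)
qed (simp add: residue_hits_def)

lemma residue_hits_base:
  assumes "e > 0"
  shows "residue_hits e t (t mod e) b = int (b div nat e)"
proof (induction b)
  case (Suc b)
  have "(int (Suc b) + t) mod e = t mod e \<longleftrightarrow> e dvd int (Suc b)"
    by (simp add: mod_eq_dvd_iff)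
  also have "\<dots> \<longleftrightarrow> nat e dvd Suc b" using assms by (simp add: nat_dvd_iff)
  finally show ?case using Suc by (simp add: residue_hits_def div_Suc dvd_eq_mod_eq_0)
qed (simp add: residue_hits_def)

text \<open>
  An abacus with \<open>E\<close> runners and the lowest \<open>m p\<close> positions of runner \<open>p\<close> occupied: the beta-sets of
  partitions without removable rim hooks of length \<open>E\<close>.
\<close>

definition beads :: "nat \<Rightarrow> (nat \<Rightarrow> nat) \<Rightarrow> nat set" where
  "beads E m = (\<lambda>(p, q). p + E * q) ` (SIGMA p:{..<E}. {..<m p})"

lemma finite_beads [simp]: "finite (beads E m)"
  by (simp add: beads_def)

lemma sum_beads: "(\<Sum>b\<in>beads E m. f b) = (\<Sum>p<E. \<Sum>q<m p. f (p + E * q))"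
proof -
  have "inj_on (\<lambda>(p, q). p + E * q) (SIGMA p:{..<E}. {..<m p})"
  proof (rule inj_onI)
    fix x y assume "x \<in> (SIGMA p:{..<E}. {..<m p})" "y \<in> (SIGMA p:{..<E}. {..<m p})"
      and eq: "(case x of (p, q) \<Rightarrow> p + E * q) = (case y of (p, q) \<Rightarrow> p + E * q)"
    then have lt: "fst x < E" "fst y < E" by auto
    from eq have "fst x + E * snd x = fst y + E * snd y" by (simp add: case_prod_beta)
    from arg_cong[OF this, of "\<lambda>b. b mod E"] arg_cong[OF this, of "\<lambda>b. b div E"] lt
    show "x = y" by (simp add: prod_eq_iff)
  qed
  then show ?thesis
    unfolding beads_def by (subst sum.reindex) (simp_all add: sum.Sigma case_prod_beta)
qed

lemma beads_const: "beads E (\<lambda>_. M) = {..<E * M}"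
proof (intro equalityI subsetI)
  fix b assume "b \<in> beads E (\<lambda>_. M)"
  then obtain p q where "b = p + E * q" "p < E" "Suc q \<le> M" by (auto simp: beads_def)
  moreover have "E * Suc q \<le> E * M" by (rule mult_le_mono2) fact
  ultimately show "b \<in> {..<E * M}" by simp
next
  fix b assume "b \<in> {..<E * M}"
  then have "E > 0" "b < E * M" by (cases E; auto)+
  then have "b = b mod E + E * (b div E)" "b mod E < E" "b div E < M"
    by (simp_all add: less_mult_imp_div_less mult.commute)
  then show "b \<in> beads E (\<lambda>_. M)" unfolding beads_def by (intro image_eqI[of _ _ "(b mod E, b div E)"]) auto
qed

lemma twice_sum_lessThan: "2 * (\<Sum>q<m. int q) = (int m)\<^sup>2 - int m"
  by (induction m) (auto simp: power2_eq_square algebra_simps)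

text \<open>
  The level one case. With \<open>M + d\<^sub>i\<close> beads on the runner of residue \<open>i\<close>, where \<open>d\<^sub>i = c\<^sub>i - c\<^sub>i\<^sub>+\<^sub>1\<close>, the
  partition encoded by the abacus has the same cyclic differences as \<open>c\<close>, because these count the
  beads in excess of \<open>M\<close> on the runners. So its residue counts agree with \<open>c\<close> up to a constant. At
  the residue of the charge, the count is the total height of the beads on their runners minus
  that for \<open>M\<close> beads on each runner, which is half the energy: the partition (a core) has
  weight \<open>0\<close>. The missing constant is the
  weight \<open>w\<close> of \<open>c\<close>, and raising the largest bead by \<open>w\<close> full turns, that is, appending \<open>w e\<close>
  nodes to the first row, supplies it.
\<close>

lemma partition_with_residue_counts:
  fixes c :: "int \<Rightarrow> int"
  assumes e: "e > 0" and nonneg: "level_one_weight e t c \<ge> 0"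
  shows "\<exists>l. is_partition l \<and>
    (\<forall>i\<in>{0..<e}. diagram_sum (\<lambda>z. of_bool ((z + t) mod e = i)) l = c i)"
proof -
  define w where "w = nat (level_one_weight e t c)"
  have w: "2 * (c (t mod e) - int w) = energy e c"
    using nonneg twice_level_one_weight[OF e, of t c] by (simp add: w_def)
  define E where "E = nat e"
  have E: "E > 0" "int E = e" using e by (auto simp: E_def)
  define d where "d i = c i - c ((i + 1) mod e)" for i
  have d0: "(\<Sum>i\<in>{0..<e}. d i) = 0" unfolding d_def by (rule sum_cyclic_differences[OF e])
  \<comment> \<open>Large enough for all runners to have at least one bead.\<close>
  define M where "M = Suc (nat (\<Sum>i\<in>{0..<e}. \<bar>d i\<bar>))"
  define m where "m p = nat (int M + d ((int p + t) mod e))" for p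
  have m: "int (m p) = int M + d ((int p + t) mod e)" for p
  proof -
    have "\<bar>d ((int p + t) mod e)\<bar> \<le> (\<Sum>i\<in>{0..<e}. \<bar>d i\<bar>)"
      by (rule member_le_sum) (use e in auto)
    moreover have "(\<Sum>i\<in>{0..<e}. \<bar>d i\<bar>) \<ge> 0" by (simp add: sum_nonneg)
    ultimately have "int M + d ((int p + t) mod e) \<ge> 0" unfolding M_def by simp
    then show ?thesis unfolding m_def by simp
  qed
  \<comment> \<open>As \<open>n\<close> is a multiple of \<open>e\<close>, residues computed from bead positions need no correction by \<open>n\<close>.\<close>
  define n where "n = E * M"
  define B where "B = beads E m"
  have "int (card B) = (\<Sum>p<E. int (m p))"
    using sum_beads[of "\<lambda>_. 1::int" E m] by (simp add: B_def)
  also have "\<dots> = int n"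
    using sum_residues[OF e, of d t] d0 by (simp add: m sum.distrib n_def E_def)
  finally have cardB: "card B = n" by simp
  have npos: "n > 0" using E by (simp add: n_def M_def)
  have B: "finite B" "B \<noteq> {}" using cardB npos by (auto simp: B_def)
  define \<beta> where "\<beta> = Max B"
  have \<beta>: "\<beta> \<in> B" "\<And>b. b \<in> B \<Longrightarrow> b \<le> \<beta>" using B by (auto simp: \<beta>_def)
  define B' where "B' = insert (\<beta> + E * w) (B - {\<beta>})"
  have notin: "\<beta> + E * w \<notin> B - {\<beta>}" using \<beta>(2) by fastforce
  have cardB': "card B' = n"
    unfolding B'_def using notin B \<beta> cardB npos by simp
  have sumB': "(\<Sum>b\<in>B'. f b) = (\<Sum>b\<in>B. f b) - f \<beta> + f (\<beta> + E * w)" for f :: "nat \<Rightarrow> int"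
    unfolding B'_def using notin B \<beta> by (simp add: sum_diff1)
  have sum_n: "(\<Sum>b<n. f b) = (\<Sum>p<E. \<Sum>q<M. f (p + E * q))" for f :: "nat \<Rightarrow> int"
    using sum_beads[of f E "\<lambda>_. M"] by (simp add: beads_const n_def)
  have "finite B'" using B by (simp add: B'_def)
  from partition_of_beta_set[OF this] obtain l where l: "is_partition l"
    and sum: "\<And>f. diagram_sum f l = (\<Sum>b\<in>B'. \<Sum>v\<in>{1..b}. f (int v - int n))
       - (\<Sum>b<n. \<Sum>v\<in>{1..b}. f (int v - int n))"
    unfolding cardB' by blast
  define C where "C i = diagram_sum (\<lambda>z. of_bool ((z + t) mod e = i)) l" for i
  have C: "C i = (\<Sum>b\<in>B'. residue_hits e t i b) - (\<Sum>b<n. residue_hits e t i b)" for i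
  proof -
    have "(int v - int n + t) mod e = (int v + t) mod e" for v
      by (simp add: mod_eq_dvd_iff n_def E)
    then show ?thesis unfolding C_def sum residue_hits_def by simp
  qed
  have step: "C i - C ((i + 1) mod e) = d i" if i: "i \<in> {0..<e}" for i
  proof -
    define h :: "nat \<Rightarrow> int" where "h b = of_bool ((int b + t) mod e = i)" for b
    have h: "h (p + E * q) = h p" for p q
    proof -
      have "(int (p + E * q) + t) mod e = (int p + t) mod e" by (simp add: mod_eq_dvd_iff E)
      then show ?thesis by (simp add: h_def)
    qed
    have "C i - C ((i + 1) mod e) =
        (\<Sum>b\<in>B'. residue_hits e t i b - residue_hits e t ((i + 1) mod e) b)
        - (\<Sum>b<n. residue_hits e t i b - residue_hits e t ((i + 1) mod e) b)"
      unfolding C by (simp add: sum_subtractf)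
    also have "\<dots> = (\<Sum>b\<in>B'. h b) - (\<Sum>b<n. h b)"
      unfolding residue_hits_diff[OF i] sum_subtractf h_def by (simp add: cardB')
    also have "\<dots> = (\<Sum>p<E. (int (m p) - int M) * h p)"
      unfolding sumB' sum_n B_def sum_beads h by (simp add: sum_subtractf left_diff_distrib)
    also have "\<dots> = (\<Sum>p<E. d ((int p + t) mod e) * of_bool ((int p + t) mod e = i))"
      by (simp add: m h_def)
    also have "\<dots> = (\<Sum>k\<in>{0..<e}. d k * of_bool (k = i))"
      unfolding E_def by (rule sum_residues[OF e])
    also have "\<dots> = d i" using i by (simp add: of_bool_def if_distrib sum.If_cases cong: if_cong)
    finally show ?thesis .
  qed
  have base: "C (t mod e) = c (t mod e)"
  proof -
    have "C (t mod e) = (\<Sum>b\<in>B'. int (b div E)) - (\<Sum>b<n. int (b div E))"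
      unfolding C residue_hits_base[OF e] E_def ..
    also have "\<dots> = (\<Sum>b\<in>B. int (b div E)) - (\<Sum>b<n. int (b div E)) + int w"
      unfolding sumB' using E by simp
    also have "\<dots> = (\<Sum>p<E. \<Sum>q<m p. int q) - (\<Sum>p<E. \<Sum>q<M. int q) + int w"
      unfolding sum_n B_def sum_beads by simp
    finally have "2 * (C (t mod e) - int w) = (\<Sum>p<E. 2 * (\<Sum>q<m p. int q)) - (\<Sum>p<E. 2 * (\<Sum>q<M. int q))"
      unfolding sum_distrib_left[symmetric] by (simp add: algebra_simps)
    also have "\<dots> = (\<Sum>p<E. (int (m p))\<^sup>2 - int (m p) - ((int M)\<^sup>2 - int M))"
      unfolding twice_sum_lessThan by (simp add: sum_subtractf)
    also have "\<dots> = (\<Sum>p<E. (d ((int p + t) mod e))\<^sup>2 + (2 * int M - 1) * d ((int p + t) mod e))"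
      unfolding m by (intro sum.cong refl) (simp add: power2_eq_square algebra_simps)
    also have "\<dots> = (\<Sum>i\<in>{0..<e}. (d i)\<^sup>2 + (2 * int M - 1) * d i)"
      unfolding E_def by (rule sum_residues[OF e])
    also have "\<dots> = energy e c"
      using d0 unfolding sum.distrib sum_distrib_left[symmetric] by (simp add: energy_def d_def)
    finally show ?thesis using w by simp
  qed
  have "C i = c i" if "i \<in> {0..<e}" for i
  proof -
    have "C i - c i = C (t mod e) - c (t mod e)"
    proof (rule cyclically_constant[where h = "\<lambda>i. C i - c i", OF _ that])
      show "C i - c i = C ((i + 1) mod e) - c ((i + 1) mod e)" if "i \<in> {0..<e}" for i
        using step[OF that] by (simp add: d_def)
    qed (use e in auto)
    then show ?thesis using base by simp
  qed
  then show ?thesis using l unfolding C_def by blast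
qed


section \<open>Residue counts of multipartitions\<close>

lemma int_residue_count:
  "int (residue_count e s L i)
    = (\<Sum>j<length L. diagram_sum (\<lambda>z. of_bool ((z + s ! j) mod e = i)) (L ! j))"
proof -
  define R where "R j = {(a, b) \<in> young_diagram (L ! j). (int b - int a + s ! j) mod e = i}" for j
  have fin: "finite (R j)" for j
    by (rule finite_subset[OF _ finite_young_diagram[of "L ! j"]]) (auto simp: R_def)
  have "{x \<in> nodes L. residue e s x = i} = (\<lambda>(j, a, b). (a, b, j)) ` (SIGMA j:{..<length L}. R j)"
    by (force simp: nodes_def residue_def R_def)
  then have "residue_count e s L i = card (SIGMA j:{..<length L}. R j)"
    unfolding residue_count_def by (auto simp: inj_on_def intro!: card_image)
  also have "\<dots> = (\<Sum>j<length L. card (R j))"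
    using fin by simp
  also have "int \<dots> = (\<Sum>j<length L. int (card (R j)))" by simp
  also have "\<dots> = (\<Sum>j<length L. diagram_sum (\<lambda>z. of_bool ((z + s ! j) mod e = i)) (L ! j))"
  proof (rule sum.cong[OF refl])
    fix j
    have "diagram_sum (\<lambda>z. of_bool ((z + s ! j) mod e = i)) (L ! j)
      = (\<Sum>x\<in>young_diagram (L ! j). of_bool (x \<in> R j))"
      unfolding diagram_sum_def by (intro sum.cong refl) (auto simp: R_def)
    also have "\<dots> = int (card (young_diagram (L ! j) \<inter> R j))"
      using finite_young_diagram[of "L ! j"] by (simp add: Int_def)
    also have "young_diagram (L ! j) \<inter> R j = R j" by (auto simp: R_def)
    finally show "int (card (R j)) = diagram_sum (\<lambda>z. of_bool ((z + s ! j) mod e = i)) (L ! j)" ..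
  qed
  finally show ?thesis .
qed

section \<open>Splitting a function into nearly equal parts\<close>

text \<open>
  Hermite's identity. Raising \<open>a\<close> by one shifts the summands by one place, which adds \<open>1\<close> in total.
\<close>

lemma sum_add_div:
  fixes a :: int
  assumes "r > 0"
  shows "(\<Sum>k<r. (a + int k) div int r) = a"
proof -
  have step: "(\<Sum>k<r. (a + 1 + int k) div int r) = (\<Sum>k<r. (a + int k) div int r) + 1" for a
  proof -
    have "(\<Sum>k<r. (a + 1 + int k) div int r) - (\<Sum>k<r. (a + int k) div int r)
      = (\<Sum>k<r. (a + int (Suc k)) div int r - (a + int k) div int r)"
      by (simp add: sum_subtractf algebra_simps)
    also have "\<dots> = (a + int r) div int r - a div int r"
      by (subst sum_lessThan_telescope) simp
    also have "\<dots> = 1" using assms by simp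
    finally show ?thesis by simp
  qed
  show ?thesis
  proof (induction a rule: int_induct[where k = 0])
    case base
    show ?case by (rule sum.neutral) auto
  next
    case (step1 i)
    then show ?case using step[of i] by simp
  next
    case (step2 i)
    then show ?case using step[of "i - 1"] by simp
  qed
qed

text \<open>
  The \<open>r\<close> differences take only the two values \<open>q\<close> and \<open>q + 1\<close>, with \<open>q\<close> the integer part
  of \<open>(x - y) / r\<close>; since they add up to \<open>x - y = q r + t\<close>, the larger one occurs exactly \<open>t\<close> times. The
  term \<open>t (r - t)\<close> is the price of rounding \<open>(x - y) / r\<close> to integers.
\<close>

lemma sum_add_div_difference_squares:
  fixes x y :: int
  assumes r: "r > 0"
  defines "t \<equiv> (x - y) mod int r"
  shows "int r * (\<Sum>k<r. ((x + int k) div int r - (y + int k) div int r)\<^sup>2)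
    = (x - y)\<^sup>2 + t * (int r - t)"
proof -
  define q where "q = (x - y) div int r"
  define \<epsilon> where "\<epsilon> k = (x + int k) div int r - (y + int k) div int r - q" for k
  have xy: "x - y = int r * q + t" by (simp add: q_def t_def)
  have t: "0 \<le> t" "t < int r" using r by (simp_all add: t_def)
  have eps: "\<epsilon> k = 0 \<or> \<epsilon> k = 1" for k
  proof -
    have "x + int k = (y + int k + t) + int r * q" using xy by simp
    then have "(x + int k) div int r = q + (y + int k + t) div int r"
      using r by (metis div_mult_self2 add.commute of_nat_0_less_iff less_irrefl)
    then have "\<epsilon> k = (y + int k + t) div int r - (y + int k) div int r" by (simp add: \<epsilon>_def)
    moreover have "(y + int k) div int r \<le> (y + int k + t) div int r"
      using t r by (intro zdiv_mono1) auto
    moreover have "(y + int k + t) div int r \<le> (y + int k + int r) div int r"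
      using t r by (intro zdiv_mono1) auto
    ultimately show ?thesis using r by auto
  qed
  have sq: "(\<epsilon> k)\<^sup>2 = \<epsilon> k" for k using eps[of k] by auto
  have "(\<Sum>k<r. \<epsilon> k) = x - y - int r * q"
    by (simp add: \<epsilon>_def sum_subtractf sum_add_div[OF r])
  then have sum: "(\<Sum>k<r. \<epsilon> k) = t" using xy by simp
  have "(\<Sum>k<r. ((x + int k) div int r - (y + int k) div int r)\<^sup>2) = (\<Sum>k<r. q\<^sup>2 + (2 * q + 1) * \<epsilon> k)"
  proof (rule sum.cong[OF refl])
    fix k
    have "(x + int k) div int r - (y + int k) div int r = q + \<epsilon> k" by (simp add: \<epsilon>_def)
    then show "((x + int k) div int r - (y + int k) div int r)\<^sup>2 = q\<^sup>2 + (2 * q + 1) * \<epsilon> k"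
      using sq[of k] by (simp add: power2_sum algebra_simps)
  qed
  also have "\<dots> = int r * q\<^sup>2 + (2 * q + 1) * t"
    by (simp add: sum.distrib sum_distrib_left[symmetric] sum)
  finally show ?thesis
    unfolding xy by (simp add: power2_eq_square algebra_simps)
qed

text \<open>
  All pairs of a charge and a part are taken into account. Then the linear terms add up by
  Hermite's identity to those of the weight of \<open>c\<close>, and the energies of the parts give back the
  energy of \<open>c\<close> up to the rounding costs. So the right-hand side is twice the weight of \<open>c\<close>
  minus these costs.
\<close>

lemma sum_level_one_weights:
  fixes c :: "int \<Rightarrow> int" and s :: "int list"
  assumes e: "e > 0" and r: "r > 0" "length s = r"
  shows "(\<Sum>j<r. \<Sum>k<r. 2 * level_one_weight e (s ! j) (\<lambda>i. (c i + int k) div int r))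
    = 2 * (\<Sum>j<r. c (s ! j mod e)) - energy e c
      - (\<Sum>i\<in>{0..<e}. ((c i - c ((i + 1) mod e)) mod int r) * (int r - (c i - c ((i + 1) mod e)) mod int r))"
proof -
  let ?p = "\<lambda>k i. (c i + int k) div int r"
  have "int r * (\<Sum>k<r. energy e (?p k))
    = (\<Sum>i\<in>{0..<e}. int r * (\<Sum>k<r. (?p k i - ?p k ((i + 1) mod e))\<^sup>2))"
    unfolding energy_def by (subst sum.swap) (simp add: sum_distrib_left)
  also have "\<dots> = energy e c
      + (\<Sum>i\<in>{0..<e}. ((c i - c ((i + 1) mod e)) mod int r) * (int r - (c i - c ((i + 1) mod e)) mod int r))"
    unfolding sum_add_div_difference_squares[OF r(1)] energy_def by (simp add: sum.distrib)
  finally show ?thesis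
    by (simp add: twice_level_one_weight[OF e] sum_subtractf sum_distrib_left[symmetric] sum_add_div[OF r(1)])
qed

section \<open>Bounding the rounding costs\<close>

text \<open>
  Writing \<open>4 t (r - t) = r\<^sup>2 - (2 t - r)\<^sup>2\<close>, a single summand is at most \<open>r\<^sup>2 / 4\<close>. For odd \<open>e\<close> not all
  summands can come close: as \<open>r\<close> divides the sum of the \<open>t\<^sub>i\<close>, the \<open>2 t\<^sub>i - r\<close> add up to an odd
  multiple of \<open>r\<close>, so by the Cauchy-Schwarz inequality the sum of their squares is at
  least \<open>r\<^sup>2 / e\<close>. This gain is the difference between \<open>e\<^sup>2 / 4\<close> and its integer part.
\<close>

lemma sum_residue_defects_le:
  fixes t :: "int \<Rightarrow> int" and e r :: int
  assumes e: "e > 0" and dvd: "r dvd (\<Sum>i\<in>{0..<e}. t i)"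
  shows "e * (\<Sum>i\<in>{0..<e}. t i * (r - t i)) \<le> r\<^sup>2 * (e\<^sup>2 div 4)"
proof -
  define T where "T = (\<Sum>i\<in>{0..<e}. t i * (r - t i))"
  define u where "u i = 2 * t i - r" for i
  from dvd obtain m where m: "(\<Sum>i\<in>{0..<e}. t i) = r * m" by blast
  define U where "U = (\<Sum>i\<in>{0..<e}. u i)"
  have U: "U = r * (2 * m - e)"
    using e unfolding U_def u_def sum_subtractf sum_distrib_left[symmetric] m
    by (simp add: algebra_simps)
  \<comment> \<open>Cauchy-Schwarz against the constant function, in the form of a nonnegative variance.\<close>
  have "0 \<le> (\<Sum>i\<in>{0..<e}. (e * u i - U)\<^sup>2)" by (simp add: sum_nonneg)
  also have "\<dots> = (\<Sum>i\<in>{0..<e}. e * e * (u i)\<^sup>2 - 2 * e * U * u i + U\<^sup>2)"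
    by (intro sum.cong refl) (simp add: power2_eq_square algebra_simps)
  also have "\<dots> = e * e * (\<Sum>i\<in>{0..<e}. (u i)\<^sup>2) - 2 * e * U * U + e * U\<^sup>2"
    using e by (simp add: sum.distrib sum_subtractf sum_distrib_left[symmetric] U_def[symmetric])
  also have "\<dots> = e * (e * (\<Sum>i\<in>{0..<e}. (u i)\<^sup>2) - U\<^sup>2)"
    by (simp add: power2_eq_square algebra_simps)
  finally have cauchy: "U\<^sup>2 \<le> e * (\<Sum>i\<in>{0..<e}. (u i)\<^sup>2)"
    using e by (simp add: zero_le_mult_iff)
  have "(\<Sum>i\<in>{0..<e}. (u i)\<^sup>2) = (\<Sum>i\<in>{0..<e}. r\<^sup>2 - 4 * (t i * (r - t i)))"
    by (intro sum.cong refl) (simp add: u_def power2_eq_square algebra_simps)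
  also have "\<dots> = e * r\<^sup>2 - 4 * T"
    using e by (simp add: sum_subtractf sum_distrib_left[symmetric] T_def)
  finally have usq: "(\<Sum>i\<in>{0..<e}. (u i)\<^sup>2) = e * r\<^sup>2 - 4 * T" .
  have odd: "e mod 2 \<le> (2 * m - e)\<^sup>2"
  proof (cases "even e")
    case False
    then have "2 * m - e \<noteq> 0" by auto
    then have "(2 * m - e)\<^sup>2 > 0" by simp
    then show ?thesis using False unfolding odd_iff_mod_2_eq_one by linarith
  qed auto
  have "e\<^sup>2 = 4 * (e\<^sup>2 div 4) + e mod 2"
  proof (cases "even e")
    case False
    then obtain k where "e = 2 * k + 1" by (auto elim: oddE)
    then have "e\<^sup>2 = 4 * (k\<^sup>2 + k) + 1" by (simp add: power2_eq_square algebra_simps)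
    then have "e\<^sup>2 mod 4 = 1" by presburger
    then show ?thesis using False mult_div_mod_eq[of 4 "e\<^sup>2"] by (simp only: odd_iff_mod_2_eq_one)
  qed (auto elim!: evenE simp: power2_eq_square)
  then have esq: "e * e = 4 * (e\<^sup>2 div 4) + e mod 2" by (simp add: power2_eq_square)
  have "r\<^sup>2 * (e mod 2) \<le> U\<^sup>2"
    unfolding U power_mult_distrib by (intro mult_left_mono odd) simp
  also note cauchy
  also have "e * (\<Sum>i\<in>{0..<e}. (u i)\<^sup>2) = r\<^sup>2 * (e * e) - 4 * (e * T)"
    unfolding usq by (simp add: algebra_simps)
  also have "\<dots> = 4 * (r\<^sup>2 * (e\<^sup>2 div 4)) + r\<^sup>2 * (e mod 2) - 4 * (e * T)"
    unfolding esq by (simp add: algebra_simps)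
  finally show ?thesis unfolding T_def by simp
qed

lemma le_N'I:
  assumes "e > 0" and "2 * e * S \<le> (int r)\<^sup>2 * (e\<^sup>2 div 4)"
  shows "S \<le> N' r e"
proof -
  have fl: "\<lfloor>(real_of_int e)\<^sup>2 / 4\<rfloor> = e\<^sup>2 div 4"
    using floor_divide_of_int_eq[of "e\<^sup>2" 4, where ?'a = real] by simp
  have "real_of_int (2 * e * S) \<le> real_of_int ((int r)\<^sup>2 * (e\<^sup>2 div 4))"
    using assms(2) by (simp only: of_int_le_iff)
  then have "real_of_int S * (2 * real_of_int e) \<le> (real r)\<^sup>2 * real_of_int (e\<^sup>2 div 4)"
    by (simp add: mult_ac)
  then show ?thesis
    unfolding N'_def fl using assms(1) by (simp add: le_floor_iff pos_le_divide_eq)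
qed

section \<open>Assigning the parts to the charges\<close>

lemma sum_rotate:
  fixes f :: "nat \<Rightarrow> int"
  assumes "a < r"
  shows "(\<Sum>j<r. f ((j + a) mod r)) = (\<Sum>k<r. f k)"
proof (rule sum.reindex_bij_witness[where i = "\<lambda>k. (k + (r - a)) mod r" and j = "\<lambda>j. (j + a) mod r"])
  fix k assume "k \<in> {..<r}"
  then show "((k + a) mod r + (r - a)) mod r = k" "((k + (r - a)) mod r + a) mod r = k"
    using assms by (simp_all only: mod_add_left_eq) simp_all
qed (use assms in auto)

text \<open>
  The \<open>r\<close> cyclic shifts together use every pair \<open>(j, k)\<close> once. If every shift had a negative
  total, then, these totals being integers, the sum over all pairs would be at most \<open>- r\<close>.
\<close>

lemma exists_cyclic_assignment:
  fixes u :: "nat \<Rightarrow> nat \<Rightarrow> int"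
  assumes "(\<Sum>j<r. \<Sum>k<r. u j k) > - int r"
  shows "\<exists>\<sigma><r. (\<Sum>j<r. u j ((j + \<sigma>) mod r)) \<ge> 0"
proof (rule ccontr)
  assume "\<not> ?thesis"
  then have le: "(\<Sum>j<r. u j ((j + \<sigma>) mod r)) \<le> -1" if "\<sigma> < r" for \<sigma> using that by force
  have "(\<Sum>j<r. \<Sum>k<r. u j k) = (\<Sum>j<r. \<Sum>\<sigma><r. u j ((j + \<sigma>) mod r))"
  proof (rule sum.cong[OF refl])
    fix j assume "j \<in> {..<r}"
    then show "(\<Sum>k<r. u j k) = (\<Sum>\<sigma><r. u j ((j + \<sigma>) mod r))"
      using sum_rotate[of j r "u j"] by (simp add: add.commute)
  qed
  also have "\<dots> = (\<Sum>\<sigma><r. \<Sum>j<r. u j ((j + \<sigma>) mod r))" by (rule sum.swap)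
  also have "\<dots> \<le> (\<Sum>\<sigma><r. -1)" by (intro sum_mono le) simp
  finally show False using assms by simp
qed

section \<open>Elements of large weight are contents\<close>

theorem theorem1:
  fixes r :: nat and e :: int and s :: "int list"
  assumes "r \<ge> 2" and "e > 0" and "length s = r"
  shows "contents e s \<supseteq> {\<alpha> \<in> root_lattice e. weight e s \<alpha> > N' r e - int r}"
proof
  fix \<alpha> assume "\<alpha> \<in> {\<alpha> \<in> root_lattice e. weight e s \<alpha> > N' r e - int r}"
  then have \<alpha>: "\<alpha> \<in> root_lattice e" and wt: "weight e s \<alpha> > N' r e - int r" by auto
  have r: "r > 0" using assms(1) by simp
  note e = \<open>e > 0\<close>
  define c where "c = Poly_Mapping.lookup \<alpha>"
  define p where "p k i = (c i + int k) div int r" for k :: nat and i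
  define t where "t i = (c i - c ((i + 1) mod e)) mod int r" for i
  define T where "T = (\<Sum>i\<in>{0..<e}. t i * (int r - t i))"
  define u where "u j k = level_one_weight e (s ! j) (p k)" for j k
  have "(\<Sum>i\<in>{0..<e}. t i) mod int r = (\<Sum>i\<in>{0..<e}. c i - c ((i + 1) mod e)) mod int r"
    unfolding t_def by (rule mod_sum_eq)
  then have "int r dvd (\<Sum>i\<in>{0..<e}. t i)"
    unfolding sum_cyclic_differences[OF e] by (simp add: dvd_eq_mod_eq_0)
  then have T: "e * T \<le> (int r)\<^sup>2 * (e\<^sup>2 div 4)"
    unfolding T_def by (rule sum_residue_defects_le[OF e])
  have weight: "2 * weight e s \<alpha> = 2 * (\<Sum>j<r. c (s ! j mod e)) - energy e c"
    using even_energy[OF e, of c] unfolding weight_def assms(3) c_def[symmetric] energy_def[symmetric]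
    by auto
  have "2 * (\<Sum>j<r. \<Sum>k<r. u j k) = 2 * weight e s \<alpha> - T"
    using sum_level_one_weights[OF e r assms(3), of c]
    unfolding weight u_def p_def T_def t_def by (simp add: sum_distrib_left)
  then have T2: "T = 2 * (weight e s \<alpha> - (\<Sum>j<r. \<Sum>k<r. u j k))" by simp
  have "weight e s \<alpha> - (\<Sum>j<r. \<Sum>k<r. u j k) \<le> N' r e"
    using T unfolding T2 by (intro le_N'I e) (simp add: mult_ac)
  then have "(\<Sum>j<r. \<Sum>k<r. u j k) > - int r" using wt by simp
  from exists_cyclic_assignment[OF this] obtain \<sigma>
    where \<sigma>: "\<sigma> < r" "(\<Sum>j<r. u j ((j + \<sigma>) mod r)) \<ge> 0" by blast
  define W where "W = (\<Sum>j<r. u j ((j + \<sigma>) mod r))"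
  \<comment> \<open>Adding \<open>b j\<close> times \<open>\<delta>\<close> brings the weight of component \<open>j\<close> to \<open>0\<close>, or to \<open>W\<close> for component \<open>0\<close>.\<close>
  define b where "b j = (if j = 0 then W else 0) - u j ((j + \<sigma>) mod r)" for j
  have sum_b: "(\<Sum>j<r. b j) = 0"
    using r by (simp add: b_def sum_subtractf W_def)
  have "\<exists>l. is_partition l \<and> (\<forall>i\<in>{0..<e}.
      diagram_sum (\<lambda>z. of_bool ((z + s ! j) mod e = i)) l = p ((j + \<sigma>) mod r) i + b j)" for j
    using \<sigma>(2) by (intro partition_with_residue_counts[OF e])
      (simp add: level_one_weight_add_const b_def u_def[symmetric] W_def)
  then obtain l where l: "\<And>j. is_partition (l j)"
    and count: "\<And>i j. i \<in> {0..<e} \<Longrightarrow>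
      diagram_sum (\<lambda>z. of_bool ((z + s ! j) mod e = i)) (l j) = p ((j + \<sigma>) mod r) i + b j"
    by metis
  define L where "L = map l [0..<r]"
  have L: "L \<in> multipartitions (length s)"
    using l by (auto simp: L_def multipartitions_def assms(3))
  have count_L: "int (residue_count e s L i) = c i" if "i \<in> {0..<e}" for i
  proof -
    have "int (residue_count e s L i) = (\<Sum>j<r. p ((j + \<sigma>) mod r) i + b j)"
      unfolding int_residue_count by (simp add: L_def count[OF that])
    also have "\<dots> = (\<Sum>j<r. p ((j + \<sigma>) mod r) i)" by (simp add: sum.distrib sum_b)
    also have "\<dots> = (\<Sum>k<r. p k i)"
      using \<sigma>(1) by (rule sum_rotate)
    also have "\<dots> = c i" unfolding p_def by (rule sum_add_div[OF r])
    finally show ?thesis .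
  qed
  have "content e s L = \<alpha>"
  proof (rule poly_mapping_eqI)
    fix i
    have "Poly_Mapping.lookup (content e s L) i
      = (\<Sum>k\<in>{0..<e}. int (residue_count e s L k) * (if i = k then 1 else 0))"
      unfolding content_def by (simp add: lookup_sum)
    also have "\<dots> = (\<Sum>k\<in>{0..<e}. if i = k then c k else 0)"
      by (rule sum.cong) (simp_all add: count_L)
    also have "\<dots> = (if i \<in> {0..<e} then c i else 0)" by (simp add: sum.delta)
    also have "\<dots> = Poly_Mapping.lookup \<alpha> i"
      using \<alpha> by (auto simp: root_lattice_def c_def in_keys_iff)
    finally show "Poly_Mapping.lookup (content e s L) i = Poly_Mapping.lookup \<alpha> i" .
  qed
  then show "\<alpha> \<in> contents e s" using L unfolding contents_def by blast
qed

end
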